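(* Let $A$ be a unital topological $*$-algebra over $\mathbb{R}$, viewed also as an algebra over the semiring $\mathbb{R}_{\ge 0}$ by restriction of scalars. Let $s\subseteq\mathbb{R}_{\ge 0}$ be a compact set, and let $\varphi,\psi : C(s,\mathbb{R}_{\ge 0})\to A$ be continuous unital $*$-homomorphisms of $\mathbb{R}_{\ge 0}$-algebras. If $\varphi$ and $\psi$ agree on the inclusion map $s\hookrightarrow\mathbb{R}_{\ge 0}$ (the restriction of the identity function to $s$), then $\varphi=\psi$.
   Context: $\mathbb{R}_{\ge 0}$ is the topological semiring of nonnegative real numbers, with trivial star operation. $C(s,\mathbb{R}_{\ge 0})$ is the $\mathbb{R}_{\ge 0}$-semialgebra of continuous functions $s\to\mathbb{R}_{\ge 0}$ with pointwise operations and trivial star, equipped with the topology of uniform convergence. A unital $*$-homomorphism of $\mathbb{R}_{\ge 0}$-algebras is a unital map preserving addition, multiplication, scalar multiplication by $\mathbb{R}_{\ge 0}$, and star. A unital topological $*$-algebra over $\mathbb{R}$ is a unital associative $\mathbb{R}$-algebra with an additive, antimultiplicative involution $x\mapsto x^*$ and a topology for which the ring operations and scalar multiplication are continuous.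
   Formalization: The topology of A is additionally assumed to be Hausdorff; without this the claim fails, for example for certain algebras A with the indiscrete topology and s = [0,1]. *)

theory Defs
  imports "HOL-Analysis.Analysis"
begin

class star =
  fixes star :: "'a \<Rightarrow> 'a"

text \<open>
  Unital algebras are taken in \<open>real_algebra + monoid_mult\<close> rather than \<open>real_algebra_1\<close>,
  because the latter excludes the zero ring by demanding \<open>0 \<noteq> 1\<close>. The involution need not
  be real-linear or continuous. The class has no separation axiom; uniqueness of continuous
  homomorphisms fails for non-Hausdorff (e.g. indiscrete) algebras, so \<open>t2_space\<close> has to be
  added to it there.
\<close>

class topological_star_algebra =
  real_algebra + monoid_mult + topological_ab_group_add + topological_semigroup_mult + star +
  assumes tendsto_scaleR_Pair:
      "LIM p (nhds c \<times>\<^sub>F nhds a). fst p *\<^sub>R snd p :> nhds (c *\<^sub>R a)"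
    and star_star: "star (star a) = a"
    and star_add: "star (a + b) = star a + star b"
    and star_mult: "star (a * b) = star b * star a"

definition nnreal_metric :: "real metric" where
  "nnreal_metric = submetric euclidean_metric {0..}"

text \<open>
  The space of bounded continuous functions from \<open>s\<close> to the nonnegative reals, with the
  supremum distance; its points are extensional on \<open>s\<close>. Boundedness is automatic for
  compact \<open>s\<close>, see \<open>mspace_cfun_nn\<close>.
\<close>

definition cfun_nn :: "real set \<Rightarrow> (real \<Rightarrow> real) metric" where
  "cfun_nn s = cfunspace (top_of_set s) nnreal_metric"

lemma mspace_cfun_nn:
  assumes "compact s"
  shows "mspace (cfun_nn s) = {f \<in> extensional s. continuous_on s f \<and> (\<forall>x\<in>s. 0 \<le> f x)}"
proof -
  have top: "mtopology_of nnreal_metric = top_of_set {0..}"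
    by (simp add: nnreal_metric_def mtopology_of_submetric)
  have sp: "mspace nnreal_metric = {0..}" "mdist nnreal_metric = dist"
    by (simp_all add: nnreal_metric_def)
  have ms: "Metric_space {0::real..} dist"
    using Metric_space_mspace_mdist[of nnreal_metric] by (simp add: sp)
  have bdd: "Metric_space.mbounded {0::real..} dist (f ` s)"
    if "continuous_map (top_of_set s) (top_of_set {0::real..}) f" for f
  proof -
    have "compactin (top_of_set {0::real..}) (f ` s)"
      using that assms by (intro image_compactin[of "top_of_set s"]) (auto simp: compactin_subtopology)
    moreover have "Metric_space.mtopology {0::real..} dist = top_of_set {0::real..}"
      using top by (simp add: mtopology_of_def sp)
    ultimately show ?thesis
      using Metric_space.compactin_imp_mbounded[OF ms] by simp
  qed
  show ?thesis
    unfolding cfun_nn_def mspace_cfunspace top sp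
    using bdd by (auto simp: continuous_map_in_subtopology)
qed

text \<open>
  Unital star-homomorphisms of algebras over the semiring of nonnegative reals. The star of
  \<open>cfun_nn s\<close> is the identity, so preservation of star means that all values are self-adjoint.
\<close>

definition unital_star_hom_nn ::
    "real set \<Rightarrow> ((real \<Rightarrow> real) \<Rightarrow> 'a::topological_star_algebra) \<Rightarrow> bool" where
  "unital_star_hom_nn s \<phi> \<longleftrightarrow>
     \<phi> (\<lambda>x\<in>s. 1) = 1 \<and>
     (\<forall>f \<in> mspace (cfun_nn s). \<forall>g \<in> mspace (cfun_nn s). \<phi> (\<lambda>x\<in>s. f x + g x) = \<phi> f + \<phi> g) \<and>
     (\<forall>f \<in> mspace (cfun_nn s). \<forall>g \<in> mspace (cfun_nn s). \<phi> (\<lambda>x\<in>s. f x * g x) = \<phi> f * \<phi> g) \<and>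
     (\<forall>c\<ge>0. \<forall>f \<in> mspace (cfun_nn s). \<phi> (\<lambda>x\<in>s. c * f x) = c *\<^sub>R \<phi> f) \<and>
     (\<forall>f \<in> mspace (cfun_nn s). \<phi> f = star (\<phi> f))"

end

(* The set on which the two homomorphisms agree contains the constants and the inclusion and is
   closed under sums and products; since addition in an algebra over the reals is cancellative, it
   also contains every nonnegative difference of two of its elements. Differences of elements of
   this set form a point-separating algebra of real functions, so by Stone-Weierstrass some such
   difference lies within e of f + e. It is then nonnegative on s, hence belongs to the set, and it
   is within 2 * e of f. A dense set of agreement suffices because the target is Hausdorff. *)

theory Submission
  imports Defs
begin

lemma mdist_cfun_nn_le:
  assumes "0 \<le> B" and "\<And>x. x \<in> s \<Longrightarrow> \<bar>f x - g x\<bar> \<le> B"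
  shows "mdist (cfun_nn s) f g \<le> B"
  unfolding cfun_nn_def using assms
  by (intro mdist_cfunspace_le) (auto simp: nnreal_metric_def dist_real_def)

text \<open>Carries the type class separation axiom over to the abstract-topology predicate, the
  form in which agreement is later extended to a closure.\<close>

lemma Hausdorff_space_euclidean_t2: "Hausdorff_space (euclidean :: 'a::t2_space topology)"
  unfolding Hausdorff_space_def by (metis hausdorff disjnt_def open_openin)

text \<open>Isolates the density argument: \<open>E\<close> stands for the set of agreement. The
  hypothesis \<open>cancel\<close> expresses closure under nonnegative differences without
  subtraction, which the semialgebra lacks.\<close>

lemma cfun_nn_closure_of_cancellative_semialgebra:
  assumes s: "compact s" "s \<subseteq> {0..}"
    and sub: "E \<subseteq> mspace (cfun_nn s)"
    and const: "\<And>c. 0 \<le> c \<Longrightarrow> (\<lambda>x\<in>s. c) \<in> E"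
    and ident: "(\<lambda>x\<in>s. x) \<in> E"
    and add: "\<And>f g. f \<in> E \<Longrightarrow> g \<in> E \<Longrightarrow> (\<lambda>x\<in>s. f x + g x) \<in> E"
    and mult: "\<And>f g. f \<in> E \<Longrightarrow> g \<in> E \<Longrightarrow> (\<lambda>x\<in>s. f x * g x) \<in> E"
    and cancel: "\<And>f g. f \<in> mspace (cfun_nn s) \<Longrightarrow> g \<in> E \<Longrightarrow> (\<lambda>x\<in>s. f x + g x) \<in> E \<Longrightarrow> f \<in> E"
  shows "mtopology_of (cfun_nn s) closure_of E = mspace (cfun_nn s)"
proof -
  interpret M: Metric_space "mspace (cfun_nn s)" "mdist (cfun_nn s)"
    by simp
  note mspace = mspace_cfun_nn[OF s(1)]
  \<comment> \<open>Only values on \<open>s\<close> count here, so total functions that are not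
    extensional, such as constants and the identity, can belong to \<open>R\<close>.\<close>
  define R where "R = {f. \<exists>u\<in>E. \<exists>v\<in>E. \<forall>x\<in>s. f x = u x - v x}"
  have R_I: "f \<in> R" if "u \<in> E" "v \<in> E" "\<And>x. x \<in> s \<Longrightarrow> f x = u x - v x" for f u v
    using that unfolding R_def by blast
  interpret R: function_ring_on R s
  proof
    show "compact s" by fact
  next
    fix f assume "f \<in> R"
    then obtain u v where uv: "u \<in> E" "v \<in> E" and f: "\<And>x. x \<in> s \<Longrightarrow> f x = u x - v x"
      unfolding R_def by blast
    have "continuous_on s u" "continuous_on s v"
      using uv sub mspace by auto
    then have "continuous_on s (\<lambda>x. u x - v x)"
      by (intro continuous_intros)
    then show "continuous_on s f"
      using f by (simp cong: continuous_on_cong)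
  next
    fix f g assume "f \<in> R" "g \<in> R"
    then obtain u v u' v' where E: "u \<in> E" "v \<in> E" "u' \<in> E" "v' \<in> E"
      and fg: "\<And>x. x \<in> s \<Longrightarrow> f x = u x - v x" "\<And>x. x \<in> s \<Longrightarrow> g x = u' x - v' x"
      unfolding R_def by blast
    show "(\<lambda>x. f x + g x) \<in> R"
      by (rule R_I[OF add[OF E(1,3)] add[OF E(2,4)]]) (simp add: fg)
    \<comment> \<open>(u - v)(u' - v') = (uu' + vv') - (uv' + vu').\<close>
    show "(\<lambda>x. f x * g x) \<in> R"
      by (rule R_I[OF add[OF mult[OF E(1,3)] mult[OF E(2,4)]] add[OF mult[OF E(1,4)] mult[OF E(2,3)]]])
        (simp add: fg algebra_simps)
  next
    fix c :: real
    \<comment> \<open>A constant is its positive part minus its negative part.\<close>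
    show "(\<lambda>_. c) \<in> R"
      by (rule R_I[OF const[of "max c 0"] const[of "max (- c) 0"]]) auto
  next
    fix x y :: real assume "x \<noteq> y"
    moreover have "(\<lambda>x. x) \<in> R"
      by (rule R_I[OF ident const[of 0]]) auto
    ultimately show "\<exists>f\<in>R. f x \<noteq> f y"
      by (intro bexI[of _ "\<lambda>x. x"])
  qed
  have "\<exists>g\<in>E. g \<in> M.mball f r" if f: "f \<in> mspace (cfun_nn s)" and r: "r > 0" for f r
  proof -
    \<comment> \<open>The final estimate is the non-strict bound 2 * e, which has to stay strictly
      below \<open>r\<close>.\<close>
    define e where "e = r / 3"
    have e: "e > 0" using r by (simp add: e_def)
    have f_props: "continuous_on s f" "\<And>x. x \<in> s \<Longrightarrow> 0 \<le> f x"
      using f mspace by auto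
    then have "continuous_on s (\<lambda>x. f x + e)"
      by (intro continuous_intros)
    \<comment> \<open>Approximating f + e rather than f to within e forces f < h < f + 2 * e on
      \<open>s\<close>.\<close>
    from R.Stone_Weierstrass_basic[OF this e] obtain h
      where h: "h \<in> R" and fh: "\<And>x. x \<in> s \<Longrightarrow> \<bar>f x + e - h x\<bar> < e"
      by blast
    from h obtain u v where uv: "u \<in> E" "v \<in> E" and huv: "\<And>x. x \<in> s \<Longrightarrow> h x = u x - v x"
      unfolding R_def by blast
    define g where "g = (\<lambda>x\<in>s. h x)"
    have "0 \<le> h x" if "x \<in> s" for x
      using fh[OF that] f_props(2)[OF that] by linarith
    then have g: "g \<in> mspace (cfun_nn s)"
      using R.continuous[OF h] by (auto simp: mspace g_def cong: continuous_on_cong)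
    \<comment> \<open>The relation h = u - v, rearranged into the sum that \<open>cancel\<close>
      expects; both sides are extensional, so equality on \<open>s\<close> suffices.\<close>
    have "(\<lambda>x\<in>s. g x + v x) = u"
      using uv sub mspace by (intro extensionalityI[of _ s]) (auto simp: g_def huv)
    then have gE: "g \<in> E"
      using cancel[OF g uv(2)] uv(1) by simp
    have "mdist (cfun_nn s) f g \<le> 2 * e"
    proof (rule mdist_cfun_nn_le)
      fix x assume "x \<in> s"
      then show "\<bar>f x - g x\<bar> \<le> 2 * e"
        using fh[of x] by (simp add: g_def abs_le_iff abs_less_iff)
    qed (use e in simp)
    also have "\<dots> < r"
      using r by (simp add: e_def)
    finally show ?thesis
      using f g gE by auto
  qed
  then show ?thesis
    unfolding mtopology_of_def M.metric_closure_of by blast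
qed

theorem mainTheorem2:
  fixes s :: "real set"
    and \<phi> \<psi> :: "(real \<Rightarrow> real) \<Rightarrow> 'a::{topological_star_algebra, t2_space}"
  assumes "compact s" and "s \<subseteq> {0..}"
    and "unital_star_hom_nn s \<phi>" and "continuous_map (mtopology_of (cfun_nn s)) euclidean \<phi>"
    and "unital_star_hom_nn s \<psi>" and "continuous_map (mtopology_of (cfun_nn s)) euclidean \<psi>"
    and "\<phi> (\<lambda>x\<in>s. x) = \<psi> (\<lambda>x\<in>s. x)"
  shows "\<forall>f \<in> mspace (cfun_nn s). \<phi> f = \<psi> f"
proof -
  define E where "E = {f \<in> mspace (cfun_nn s). \<phi> f = \<psi> f}"
  note mspace = mspace_cfun_nn[OF assms(1)]
  have add_mem: "(\<lambda>x\<in>s. f x + g x) \<in> mspace (cfun_nn s)"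
    and mult_mem: "(\<lambda>x\<in>s. f x * g x) \<in> mspace (cfun_nn s)"
    if "f \<in> mspace (cfun_nn s)" "g \<in> mspace (cfun_nn s)" for f g
    using that by (auto simp: mspace intro!: continuous_intros cong: continuous_on_cong)
  have const_mem: "(\<lambda>x\<in>s. c) \<in> mspace (cfun_nn s)" if "0 \<le> c" for c
    using that by (auto simp: mspace cong: continuous_on_cong)
  have hom: "\<theta> (\<lambda>x\<in>s. f x + g x) = \<theta> f + \<theta> g" "\<theta> (\<lambda>x\<in>s. f x * g x) = \<theta> f * \<theta> g"
    if "unital_star_hom_nn s \<theta>" "f \<in> mspace (cfun_nn s)" "g \<in> mspace (cfun_nn s)"
    for \<theta> :: "(real \<Rightarrow> real) \<Rightarrow> 'a" and f g
    using that unfolding unital_star_hom_nn_def by blast+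
  have hom_const: "\<theta> (\<lambda>x\<in>s. c) = c *\<^sub>R 1"
    if \<theta>: "unital_star_hom_nn s \<theta>" and c: "0 \<le> c" for \<theta> :: "(real \<Rightarrow> real) \<Rightarrow> 'a" and c
  proof -
    \<comment> \<open>The constant is written as a scalar multiple of the unit, whose image is
      prescribed.\<close>
    have "\<theta> (\<lambda>x\<in>s. c) = \<theta> (\<lambda>x\<in>s. c * (\<lambda>x\<in>s. 1) x)"
      by (rule arg_cong[where f = \<theta>]) auto
    also have "\<dots> = c *\<^sub>R \<theta> (\<lambda>x\<in>s. 1)"
      using \<theta> c const_mem[OF zero_le_one] unfolding unital_star_hom_nn_def by blast
    finally show ?thesis
      using \<theta> unfolding unital_star_hom_nn_def by simp
  qed
  have "mtopology_of (cfun_nn s) closure_of E = mspace (cfun_nn s)"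
  proof (rule cfun_nn_closure_of_cancellative_semialgebra[OF assms(1,2)])
    show "E \<subseteq> mspace (cfun_nn s)"
      by (auto simp: E_def)
    show "(\<lambda>x\<in>s. c) \<in> E" if "0 \<le> c" for c
      using that const_mem hom_const[OF assms(3)] hom_const[OF assms(5)] by (simp add: E_def)
    show "(\<lambda>x\<in>s. x) \<in> E"
      using assms(2,7) by (simp add: E_def mspace subset_iff cong: continuous_on_cong)
    show "(\<lambda>x\<in>s. f x + g x) \<in> E" "(\<lambda>x\<in>s. f x * g x) \<in> E" if "f \<in> E" "g \<in> E" for f g
      using that add_mem mult_mem hom[OF assms(3)] hom[OF assms(5)] by (simp_all add: E_def)
    \<comment> \<open>Here \<phi> f + \<phi> g = \<psi> f + \<psi> g with \<phi> g = \<psi> g, and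
      the common summand cancels in the additive group of the target.\<close>
    show "f \<in> E" if "f \<in> mspace (cfun_nn s)" "g \<in> E" "(\<lambda>x\<in>s. f x + g x) \<in> E" for f g
      using that hom(1)[OF assms(3)] hom(1)[OF assms(5)] by (simp add: E_def)
  qed
  then have "f \<in> mtopology_of (cfun_nn s) closure_of E" if "f \<in> mspace (cfun_nn s)" for f
    using that by simp
  \<comment> \<open>Two continuous maps into a Hausdorff space agree on a closed set, so agreement
    on \<open>E\<close> passes to its closure.\<close>
  then have "\<phi> f = \<psi> f" if "f \<in> mspace (cfun_nn s)" for f
    by (rule forall_in_closure_of_eq[OF _ Hausdorff_space_euclidean_t2 assms(4,6)])
      (use that in \<open>auto simp: E_def\<close>)
  then show ?thesis
    by blast
qed

end
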